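(* Let $m>1$ and $n\ge1$ be integers, let $P_1,\dots,P_m$ be $n\times n$ real orthogonal projection matrices with images $\mathcal{P}_1,\dots,\mathcal{P}_m$, let $P=\mathrm{diagonal}\{P_1,\dots,P_m\}$ be the corresponding $mn\times mn$ block diagonal matrix, let $I$ be the $n\times n$ identity, and suppose that $\bigcap_{i=1}^m\mathcal{P}_i=0$. Let $l$ be a positive integer, let $\mathcal{C}$ be an $l$-compact subset of $m\times m$ stochastic matrices, and define $$\lambda=\Bigl(\sup_{\mathcal{H}_\omega\in\mathcal{C}_l}\ \sup_{\mathcal{H}_{\omega-1}\in\mathcal{C}_l}\cdots\sup_{\mathcal{H}_1\in\mathcal{C}_l}\|P(Q_{\omega l}\otimes I)P(Q_{\omega l-1}\otimes I)\cdots P(Q_1\otimes I)P\|\Bigr)^{\frac{1}{\omega l}}$$ where $\omega=(m-1)^2$ and for $i\in\{1,\dots,\omega\}$, $\mathcal{H}_i$ is the subsequence $Q_{(i-1)l+1},Q_{(i-1)l+2},\dots,Q_{il}$. Then $\lambda<1$, and for any infinite sequence of stochastic matrices $S_1,S_2,\dots$ in $\mathcal{C}$ whose graphs form a sequence $\gamma(S_1),\gamma(S_2),\dots$ which is repeatedly jointly strongly connected by contiguous subsequences of length $l$, the following inequality holds: $$\|P(S_t\otimes I)P(S_{t-1}\otimes I)\cdots P(S_1\otimes I)P\|\le\lambda^{(t-l\omega)},\qquad t\ge1.$$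
   Context: A stochastic matrix is a square matrix with nonnegative entries and all row sums equal to $1$. $\otimes$ is the Kronecker product. Mixed matrix norm: for an $m\times m$ block matrix $Q=[Q_{ij}]\in\mathbb{R}^{mn\times mn}$ with blocks $Q_{ij}\in\mathbb{R}^{n\times n}$, let $\langle Q\rangle\in\mathbb{R}^{m\times m}$ be the matrix whose $ij$th entry is $|Q_{ij}|_2$ (induced two-norm), and set $\|Q\|=|\langle Q\rangle|_\infty$, where $|\cdot|_\infty$ is the induced infinity norm (maximum absolute row sum). Graphs: $\mathcal{G}_{sa}$ is the set of directed graphs on $\{1,\dots,m\}$ with self-arcs at all vertices. The graph $\gamma(M)$ of a nonnegative $m\times m$ matrix $M$ has vertex set $\{1,\dots,m\}$ and an arc $(i,j)$ from $i$ to $j$ exactly when the $ji$th entry of $M$ is nonzero. For $\mathbb{G}_p,\mathbb{G}_q\in\mathcal{G}_{sa}$ the composition $\mathbb{G}_q\circ\mathbb{G}_p$ has $(i,j)$ as an arc exactly when there is a vertex $k$ such that $(i,k)$ is an arc in $\mathbb{G}_p$ and $(k,j)$ is an arc in $\mathbb{G}_q$; composition is associative. An infinite sequence $\mathbb{G}_1,\mathbb{G}_2,\dots$ in $\mathcal{G}_{sa}$ is repeatedly jointly strongly connected by contiguous subsequences of length $l$ if for some finite positive integer $\tau_0$ and each integer $k>0$ the composed graph $\mathbb{G}_{kl+\tau_0-1}\circ\mathbb{G}_{kl+\tau_0-2}\circ\cdots\circ\mathbb{G}_{(k-1)l+\tau_0}$ is strongly connected. $l$-compactness: a compact subset $\mathcal{C}$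 of $m\times m$ stochastic matrices with graphs in $\mathcal{G}_{sa}$ is $l$-compact if the set $\mathcal{C}_l$ consisting of all sequences $S_1,S_2,\dots,S_l$, $S_i\in\mathcal{C}$, for which the graph $\gamma(S_lS_{l-1}\cdots S_1)$ is strongly connected, is nonempty and compact.
   Formalization: The stated inequality can fail when τ₀ ≥ 3; here τ₀ is explicit and the exponent is t − lω − max(0, τ₀ − 2), which is the original bound for τ₀ ≤ 2. If λ = 0, negative powers of λ are read as +∞. *)

theory Defs
  imports
    "HOL-Analysis.Analysis"
    "Graph_Theory.Digraph_Component"
    "Graph_Theory.Pair_Digraph"
begin

section \<open>Matrices\<close>

definition stochastic_matrix :: "real ^ 'm ^ 'm \<Rightarrow> bool" where
  "stochastic_matrix S \<longleftrightarrow> (\<forall>i j. 0 \<le> S $ i $ j) \<and> (\<forall>i. (\<Sum>j\<in>UNIV. S $ i $ j) = 1)"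

definition orthogonal_projection_matrix :: "real ^ 'n ^ 'n \<Rightarrow> bool" where
  "orthogonal_projection_matrix A \<longleftrightarrow> A ** A = A \<and> transpose A = A"

definition matrix_image :: "real ^ 'n ^ 'n \<Rightarrow> (real ^ 'n) set" where
  "matrix_image A = range ((*v) A)"

text \<open>An $mn \times mn$ matrix, partitioned into $m^2$ blocks of size $n \times n$, has the index
  type \<^typ>\<open>'m \<times> 'n\<close>: the pair $(i,a)$ is the $a$th position inside the $i$th block.\<close>

definition kronecker :: "real ^ 'm::finite ^ 'm \<Rightarrow> real ^ 'n::finite ^ 'n \<Rightarrow> real ^ ('m \<times> 'n) ^ ('m \<times> 'n)"
    (infixl \<open>\<otimes>\<^sub>K\<close> 75) where
  "A \<otimes>\<^sub>K B = (\<chi> p q. A $ fst p $ fst q * B $ snd p $ snd q)"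

definition block_diagonal :: "('m::finite \<Rightarrow> real ^ 'n::finite ^ 'n) \<Rightarrow> real ^ ('m \<times> 'n) ^ ('m \<times> 'n)" where
  "block_diagonal D = (\<chi> p q. if fst p = fst q then D (fst p) $ snd p $ snd q else 0)"

definition block :: "real ^ ('m::finite \<times> 'n::finite) ^ ('m \<times> 'n) \<Rightarrow> 'm \<Rightarrow> 'm \<Rightarrow> real ^ 'n ^ 'n" where
  "block Q i j = (\<chi> a b. Q $ (i, a) $ (j, b))"

definition matrix_two_norm :: "real ^ 'n ^ 'n \<Rightarrow> real" where
  "matrix_two_norm A = onorm ((*v) A)"

definition matrix_inf_norm :: "real ^ 'm ^ 'm \<Rightarrow> real" where
  "matrix_inf_norm A = Max (range (\<lambda>i. \<Sum>j\<in>UNIV. \<bar>A $ i $ j\<bar>))"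

definition mixed_norm :: "real ^ ('m::finite \<times> 'n::finite) ^ ('m \<times> 'n) \<Rightarrow> real" where
  "mixed_norm Q = matrix_inf_norm (\<chi> i j. matrix_two_norm (block Q i j))"

text \<open>\<open>matrix_chain S k\<close> is $S_k S_{k-1} \cdots S_1$, and \<open>projected_chain P S k\<close> is
  $P (S_k \otimes I) P (S_{k-1} \otimes I) \cdots P (S_1 \otimes I) P$. Sequences of matrices are
  indexed from 1; the value at 0 is never used.\<close>

primrec matrix_chain :: "(nat \<Rightarrow> real ^ 'm ^ 'm) \<Rightarrow> nat \<Rightarrow> real ^ 'm ^ 'm" where
  "matrix_chain S 0 = mat 1"
| "matrix_chain S (Suc k) = S (Suc k) ** matrix_chain S k"

primrec projected_chain ::
    "real ^ ('m::finite \<times> 'n::finite) ^ ('m \<times> 'n) \<Rightarrow> (nat \<Rightarrow> real ^ 'm ^ 'm) \<Rightarrow> nat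
      \<Rightarrow> real ^ ('m \<times> 'n) ^ ('m \<times> 'n)" where
  "projected_chain P S 0 = P"
| "projected_chain P S (Suc k) =
     P ** (S (Suc k) \<otimes>\<^sub>K (mat 1 :: real ^ 'n ^ 'n)) ** projected_chain P S k"


section \<open>Graphs\<close>

definition self_arc_graphs :: "'m pair_pre_digraph set" where
  "self_arc_graphs = {G. pverts G = UNIV \<and> (\<forall>i. (i, i) \<in> parcs G)}"

definition matrix_graph :: "real ^ 'm ^ 'm \<Rightarrow> 'm pair_pre_digraph" where
  "matrix_graph M = \<lparr> pverts = UNIV, parcs = {(i, j). M $ j $ i \<noteq> 0} \<rparr>"

definition graph_comp ::
    "'m pair_pre_digraph \<Rightarrow> 'm pair_pre_digraph \<Rightarrow> 'm pair_pre_digraph"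
    (infixl \<open>\<circ>\<^sub>G\<close> 55) where
  "Gq \<circ>\<^sub>G Gp =
     \<lparr> pverts = UNIV, parcs = {(i, j). \<exists>k. (i, k) \<in> parcs Gp \<and> (k, j) \<in> parcs Gq} \<rparr>"

text \<open>\<open>graph_chain G s k\<close> is $G_{s+k} \circ G_{s+k-1} \circ \cdots \circ G_s$, which has
  $k + 1$ factors.\<close>

primrec graph_chain ::
    "(nat \<Rightarrow> 'm pair_pre_digraph) \<Rightarrow> nat \<Rightarrow> nat \<Rightarrow> 'm pair_pre_digraph" where
  "graph_chain G s 0 = G s"
| "graph_chain G s (Suc k) = G (s + Suc k) \<circ>\<^sub>G graph_chain G s k"

text \<open>The starting time \<open>\<tau>\<^sub>0\<close> is a parameter rather than existentially quantified because the
  decay of the matrix products depends on it: members of a compact set may be multiplied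
  arbitrarily often before time \<open>\<tau>\<^sub>0\<close> without any contraction. For example, take two agents with
  $P_1 = 1$ and $P_2 = 0$ in dimension 1, $l = 1$, and a set consisting of the identity and of the
  matrix with all entries $1/2$. The only strongly connected choice is the latter, and it gives
  the rate $1/2$, but along a sequence starting with $\tau_0 - 1$ identities the norm of the
  product is still 1 at time $\tau_0 - 1$. So an exponent $t - l\omega$ is valid for all sequences
  only if $\tau_0 \le 2$; every further unit of delay costs one factor.\<close>

definition repeatedly_jointly_strongly_connected_from ::
    "nat \<Rightarrow> nat \<Rightarrow> (nat \<Rightarrow> 'm pair_pre_digraph) \<Rightarrow> bool" where
  "repeatedly_jointly_strongly_connected_from \<tau>\<^sub>0 l G \<longleftrightarrow>
     (\<forall>k>0. strongly_connected (with_proj (graph_chain G ((k - 1) * l + \<tau>\<^sub>0) (l - 1))))"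


section \<open>Compactness\<close>

text \<open>A finite sequence $S_1, \dots, S_l$ is a function on \<open>{1..l}\<close>, extended by \<^const>\<open>undefined\<close>;
  the product topology below is the topology of $(\mathbb{R}^{m \times m})^l$.\<close>

definition connected_sequences ::
    "nat \<Rightarrow> (real ^ 'm ^ 'm) set \<Rightarrow> (nat \<Rightarrow> real ^ 'm ^ 'm) set" where
  "connected_sequences l C =
     {H \<in> {1..l} \<rightarrow>\<^sub>E C. strongly_connected (with_proj (matrix_graph (matrix_chain H l)))}"

definition l_compact :: "nat \<Rightarrow> (real ^ 'm ^ 'm) set \<Rightarrow> bool" where
  "l_compact l C \<longleftrightarrow>
     compact C \<and>
     (\<forall>S\<in>C. stochastic_matrix S \<and> matrix_graph S \<in> self_arc_graphs) \<and>
     connected_sequences l C \<noteq> {} \<and>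
     compactin (product_topology (\<lambda>_. euclidean) {1..l}) (connected_sequences l C)"


section \<open>Nested suprema and the convergence rate\<close>

text \<open>\<open>iterated_sup A k F\<close> is
  $\sup_{H_k \in A} \sup_{H_{k-1} \in A} \cdots \sup_{H_1 \in A} F [H_1, \dots, H_k]$.\<close>

primrec iterated_sup :: "'h set \<Rightarrow> nat \<Rightarrow> ('h list \<Rightarrow> real) \<Rightarrow> real" where
  "iterated_sup A 0 F = F []"
| "iterated_sup A (Suc k) F = (SUP h\<in>A. iterated_sup A k (\<lambda>hs. F (hs @ [h])))"

text \<open>Writing $Q$ for \<open>concatenated l [H\<^sub>1, \<dots>, H\<^sub>k]\<close>, the sequence $H_i$ consists of
  $Q_{(i-1)l+1}, \dots, Q_{il}$.\<close>

definition concatenated :: "nat \<Rightarrow> (nat \<Rightarrow> 'a) list \<Rightarrow> nat \<Rightarrow> 'a" where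
  "concatenated l hs k = (hs ! ((k - 1) div l)) ((k - 1) mod l + 1)"

text \<open>Integer powers of a nonnegative base, with $0^k = \infty$ for $k < 0$. The library has
  \<open>0 powi k = 0\<close> in that case, which as an upper bound would assert that the bounded quantity
  vanishes.\<close>

definition ereal_powi :: "real \<Rightarrow> int \<Rightarrow> ereal" where
  "ereal_powi x k = (if x = 0 \<and> k < 0 then \<infinity> else ereal (x powi k))"

end

(*
  The i-th block row of P (S_t x I) P ... (S_1 x I) P is a sum over the walks of length t ending
  at i, each walk contributing its weight in S_t ... S_1 times the product of the projections met
  along it. The weights add up to 1 and projections are nonexpansive, so every row norm is at most
  1. It is less than 1 as soon as one walk of positive weight visits every vertex: a vector whose
  norm is preserved by a product of projections is fixed by each factor, so a product of all the
  P_i preserves the norm of no nonzero vector. The composition of m - 1 strongly connected graphs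
  with self-arcs is complete, because each of them enlarges the set of vertices reached so far;
  hence m - 1 rounds of m - 1 blocks let a walk visit all m vertices and end anywhere. Compactness makes the
  bound uniform, and submultiplicativity of the norm gives the geometric decay.
*)
theory Submission
  imports Defs
begin

subsection \<open>Norms of block matrices\<close>

definition block_row_norm :: "real ^ ('m::finite \<times> 'n::finite) ^ ('m \<times> 'n) \<Rightarrow> 'm \<Rightarrow> real" where
  "block_row_norm Q i = (\<Sum>j\<in>UNIV. matrix_two_norm (block Q i j))"

lemma matrix_two_norm_nonneg [simp]: "0 \<le> matrix_two_norm A"
  unfolding matrix_two_norm_def by (intro onorm_pos_le) simp

lemma matrix_two_norm_le:
  assumes "\<And>x. norm (A *v x) \<le> b * norm x"
  shows "matrix_two_norm A \<le> b"
  unfolding matrix_two_norm_def by (intro onorm_le assms)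

lemma norm_matrix_vector_le: "norm (A *v x) \<le> matrix_two_norm A * norm x"
  unfolding matrix_two_norm_def by (intro onorm) simp

lemma matrix_two_norm_zero [simp]: "matrix_two_norm 0 = 0"
  by (rule order_antisym[OF matrix_two_norm_le]) simp_all

lemma matrix_two_norm_triangle: "matrix_two_norm (A + B) \<le> matrix_two_norm A + matrix_two_norm B"
proof (rule matrix_two_norm_le)
  fix x
  have "norm ((A + B) *v x) \<le> norm (A *v x) + norm (B *v x)"
    by (simp add: matrix_vector_mult_add_rdistrib norm_triangle_ineq)
  also have "\<dots> \<le> (matrix_two_norm A + matrix_two_norm B) * norm x"
    using norm_matrix_vector_le[of A x] norm_matrix_vector_le[of B x] by (simp add: algebra_simps)
  finally show "norm ((A + B) *v x) \<le> (matrix_two_norm A + matrix_two_norm B) * norm x" .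
qed

lemma matrix_two_norm_sum: "matrix_two_norm (\<Sum>k\<in>K. A k) \<le> (\<Sum>k\<in>K. matrix_two_norm (A k))"
proof (induction K rule: infinite_finite_induct)
  case (insert k K)
  then show ?case
    using matrix_two_norm_triangle[of "A k" "\<Sum>k\<in>K. A k"] by simp
qed auto

lemma matrix_two_norm_mult: "matrix_two_norm (A ** B) \<le> matrix_two_norm A * matrix_two_norm B"
proof (rule matrix_two_norm_le)
  fix x
  have "norm ((A ** B) *v x) \<le> matrix_two_norm A * norm (B *v x)"
    by (metis matrix_vector_mul_assoc norm_matrix_vector_le)
  also have "\<dots> \<le> matrix_two_norm A * (matrix_two_norm B * norm x)"
    by (intro mult_left_mono norm_matrix_vector_le) simp
  finally show "norm ((A ** B) *v x) \<le> matrix_two_norm A * matrix_two_norm B * norm x"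
    by (simp add: mult.assoc)
qed

lemma matrix_two_norm_scaleR: "matrix_two_norm (c *\<^sub>R A) = \<bar>c\<bar> * matrix_two_norm A"
proof -
  have "(*v) (c *\<^sub>R A) = (\<lambda>x. c *\<^sub>R (A *v x))"
    by (auto simp: scaleR_matrix_vector_assoc)
  then show ?thesis
    unfolding matrix_two_norm_def by (simp add: onorm_scaleR)
qed

lemma matrix_two_norm_minus_commute: "matrix_two_norm (A - B) = matrix_two_norm (B - A)"
  using matrix_two_norm_scaleR[of "-1" "A - B"] by simp

text \<open>The crude constant suffices: the bound serves only to make the two-norm
  continuous.\<close>

lemma matrix_two_norm_le_norm:
  fixes A :: "real ^ 'n ^ 'n"
  shows "matrix_two_norm A \<le> real CARD('n) * real CARD('n) * norm A"
proof -
  have "\<bar>A $ i $ j\<bar> \<le> norm A" for i j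
    by (meson component_le_norm_cart Finite_Cartesian_Product.norm_nth_le order_trans)
  then show ?thesis
    unfolding matrix_two_norm_def by (rule onorm_le_matrix_component)
qed

lemma tendsto_matrix_two_norm:
  fixes f :: "'a \<Rightarrow> real ^ 'n ^ 'n"
  assumes "(f \<longlongrightarrow> A) F"
  shows "((\<lambda>x. matrix_two_norm (f x)) \<longlongrightarrow> matrix_two_norm A) F"
proof -
  let ?K = "real CARD('n) * real CARD('n)"
  have "((\<lambda>x. ?K * norm (f x - A)) \<longlongrightarrow> ?K * norm (A - A)) F"
    by (intro tendsto_intros assms)
  then have lim: "((\<lambda>x. ?K * norm (f x - A)) \<longlongrightarrow> 0) F"
    by simp
  have "\<bar>matrix_two_norm (f x) - matrix_two_norm A\<bar> \<le> ?K * norm (f x - A)" for x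
    using matrix_two_norm_triangle[of "f x - A" A] matrix_two_norm_triangle[of "A - f x" "f x"]
      matrix_two_norm_minus_commute[of A "f x"] matrix_two_norm_le_norm[of "f x - A"]
    by (simp add: abs_le_iff)
  then have "((\<lambda>x. matrix_two_norm (f x) - matrix_two_norm A) \<longlongrightarrow> 0) F"
    by (intro Lim_null_comparison[OF _ lim] always_eventually) simp
  then show ?thesis
    by (simp add: LIM_zero_iff)
qed

text \<open>The operator norm is attained because the unit sphere is compact.\<close>

lemma matrix_two_norm_less_one:
  assumes nonexpansive: "\<And>x. norm (M *v x) \<le> norm x"
    and fixed: "\<And>x. norm (M *v x) = norm x \<Longrightarrow> x = 0"
  shows "matrix_two_norm M < 1"
proof -
  let ?S = "sphere 0 1 :: (real ^ _) set"
  have "?S \<noteq> {}"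
    by (metis sphere_eq_empty not_one_less_zero)
  moreover have "continuous_on ?S (\<lambda>x. norm (M *v x))"
    by (intro continuous_on_norm linear_continuous_on) simp
  ultimately obtain x where x: "x \<in> ?S" and max: "\<And>y. y \<in> ?S \<Longrightarrow> norm (M *v y) \<le> norm (M *v x)"
    using continuous_attains_sup[of ?S "\<lambda>x. norm (M *v x)"] by auto
  have "matrix_two_norm M \<le> norm (M *v x)"
  proof (rule matrix_two_norm_le)
    fix y
    show "norm (M *v y) \<le> norm (M *v x) * norm y"
    proof (cases "y = 0")
      case False
      then have "norm (M *v ((1 / norm y) *\<^sub>R y)) \<le> norm (M *v x)"
        by (intro max) simp
      with False show ?thesis
        by (simp add: matrix_vector_mult_scaleR field_simps)
    qed simp
  qed
  moreover have "norm (M *v x) < norm x"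
    using nonexpansive[of x] fixed[of x] x by fastforce
  ultimately show ?thesis
    using x by simp
qed

lemma mixed_norm_eq: "mixed_norm Q = Max (range (block_row_norm Q))"
  unfolding mixed_norm_def matrix_inf_norm_def block_row_norm_def[abs_def] by simp

lemma block_row_norm_le_mixed_norm: "block_row_norm Q i \<le> mixed_norm Q"
  unfolding mixed_norm_eq by (intro Max_ge) auto

lemma mixed_norm_le_iff: "mixed_norm Q \<le> c \<longleftrightarrow> (\<forall>i. block_row_norm Q i \<le> c)"
  unfolding mixed_norm_eq by (subst Max_le_iff) auto

lemma block_row_norm_nonneg: "0 \<le> block_row_norm Q i"
  unfolding block_row_norm_def by (intro sum_nonneg) simp

lemma mixed_norm_nonneg [simp]: "0 \<le> mixed_norm Q"
  using block_row_norm_nonneg block_row_norm_le_mixed_norm order_trans by blast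

section \<open>Blocks of products and submultiplicativity of the mixed norm\<close>

lemma matrix_mult_scaleR_left:
  fixes A B :: "real ^ 'n ^ 'n"
  shows "(c *\<^sub>R A) ** B = c *\<^sub>R (A ** B)"
  by (simp add: vec_eq_iff matrix_matrix_mult_def sum_distrib_left mult.assoc)

lemma matrix_mult_scaleR_right:
  fixes A B :: "real ^ 'n ^ 'n"
  shows "A ** (c *\<^sub>R B) = c *\<^sub>R (A ** B)"
  by (simp add: vec_eq_iff matrix_matrix_mult_def sum_distrib_left mult.left_commute)

lemma matrix_mult_diff_right:
  fixes A B C :: "real ^ 'n ^ 'n"
  shows "A ** (B - C) = A ** B - A ** C"
  by (simp add: vec_eq_iff matrix_matrix_mult_def right_diff_distrib sum_subtractf)

lemma block_mult:
  fixes A B :: "real ^ ('m::finite \<times> 'n::finite) ^ ('m \<times> 'n)"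
  shows "block (A ** B) i j = (\<Sum>k\<in>UNIV. block A i k ** block B k j)"
proof -
  have "(\<Sum>p\<in>UNIV. A $ (i, a) $ p * B $ p $ (j, b)) =
      (\<Sum>k\<in>UNIV. \<Sum>c\<in>UNIV. A $ (i, a) $ (k, c) * B $ (k, c) $ (j, b))" for a b
   by (simp add: sum.cartesian_product flip: UNIV_Times_UNIV)
  then show ?thesis
    by (simp add: vec_eq_iff block_def matrix_matrix_mult_def sum_component)
qed

lemma block_kronecker: "block (A \<otimes>\<^sub>K B) i j = A $ i $ j *\<^sub>R B"
  by (simp add: vec_eq_iff block_def kronecker_def)

lemma block_block_diagonal: "block (block_diagonal D) i j = (if i = j then D i else 0)"
  by (simp add: vec_eq_iff block_def block_diagonal_def)

lemma block_eqI: "(\<And>i j. block A i j = block B i j) \<Longrightarrow> A = B"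
  by (simp add: vec_eq_iff block_def)

lemma block_row_norm_mult: "block_row_norm (A ** B) i \<le> block_row_norm A i * mixed_norm B"
proof -
  have "block_row_norm (A ** B) i \<le>
      (\<Sum>j\<in>UNIV. \<Sum>k\<in>UNIV. matrix_two_norm (block A i k) * matrix_two_norm (block B k j))"
    unfolding block_row_norm_def block_mult
    by (intro sum_mono order_trans[OF matrix_two_norm_sum] matrix_two_norm_mult)
  also have "\<dots> = (\<Sum>k\<in>UNIV. matrix_two_norm (block A i k) * block_row_norm B k)"
    unfolding block_row_norm_def sum_distrib_left by (rule sum.swap)
  also have "\<dots> \<le> (\<Sum>k\<in>UNIV. matrix_two_norm (block A i k) * mixed_norm B)"
    by (intro sum_mono mult_left_mono block_row_norm_le_mixed_norm) simp
  finally show ?thesis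
    by (simp add: block_row_norm_def sum_distrib_right)
qed

lemma mixed_norm_mult: "mixed_norm (A ** B) \<le> mixed_norm A * mixed_norm B"
  unfolding mixed_norm_le_iff
  by (intro allI order_trans[OF block_row_norm_mult] mult_right_mono block_row_norm_le_mixed_norm
      mixed_norm_nonneg)

subsection \<open>Products of projections and stochastic matrices\<close>

text \<open>Symmetry and idempotence give Ax . x = Ax . Ax, hence |x - Ax|^2 = |x|^2 - |Ax|^2, from
  which both claims are read off.\<close>

lemma orthogonal_projection_norm:
  assumes "orthogonal_projection_matrix A"
  shows "norm (A *v x) \<le> norm x"
    and "norm (A *v x) = norm x \<Longrightarrow> A *v x = x"
proof -
  have "(A *v x) \<bullet> x = (A *v x) \<bullet> (A *v x)"
    using assms unfolding orthogonal_projection_matrix_def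
    by (metis dot_lmul_matrix matrix_vector_mul_assoc vector_transpose_matrix)
  then have *: "(norm (x - A *v x))\<^sup>2 = (norm x)\<^sup>2 - (norm (A *v x))\<^sup>2"
    by (simp add: power2_norm_eq_inner inner_diff_left inner_diff_right inner_commute)
  then show "norm (A *v x) \<le> norm x"
    by (metis diff_ge_0_iff_ge norm_ge_zero power2_le_imp_le zero_le_power2)
  show "A *v x = x" if "norm (A *v x) = norm x"
    using * that by simp
qed

lemma projected_chain_cong:
  "(\<And>k. 1 \<le> k \<Longrightarrow> k \<le> t \<Longrightarrow> S k = T k) \<Longrightarrow> projected_chain P S t = projected_chain P T t"
  by (induction t) auto

lemma matrix_chain_cong:
  "(\<And>k. 1 \<le> k \<Longrightarrow> k \<le> t \<Longrightarrow> S k = T k) \<Longrightarrow> matrix_chain S t = matrix_chain T t"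
  by (induction t) auto

locale projection_family =
  fixes Pr :: "'m::finite \<Rightarrow> real ^ 'n::finite ^ 'n"
  assumes projection: "\<And>i. orthogonal_projection_matrix (Pr i)"
begin

abbreviation "chain \<equiv> projected_chain (block_diagonal Pr)"

lemma matrix_two_norm_projection: "matrix_two_norm (Pr i) \<le> 1"
  by (rule matrix_two_norm_le) (simp add: orthogonal_projection_norm(1) projection)

lemma block_diagonal_idem: "block_diagonal Pr ** block_diagonal Pr = block_diagonal Pr"
proof (rule block_eqI)
  fix i j
  have "Pr i ** Pr i = Pr i"
    using projection[of i] by (simp add: orthogonal_projection_matrix_def)
  then have "(\<Sum>k\<in>UNIV. (if i = k then Pr i else 0) ** (if k = j then Pr k else 0)) =
      (if i = j then Pr i else 0)"
    by (subst sum.remove[of UNIV i]) (auto intro!: sum.neutral)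
  then show "block (block_diagonal Pr ** block_diagonal Pr) i j = block (block_diagonal Pr) i j"
    by (simp only: block_mult block_block_diagonal)
qed

text \<open>Both factors on the right contribute a copy of \<open>block_diagonal Pr\<close> at the
  junction; idempotence merges them.\<close>

lemma chain_add: "chain S (s + t) = chain (\<lambda>k. S (s + k)) t ** chain S s"
proof (induction t)
  case 0
  show ?case
    by (cases s) (simp_all add: matrix_mul_assoc block_diagonal_idem)
next
  case (Suc t)
  then show ?case
    by (simp add: matrix_mul_assoc)
qed

text \<open>A walk ending at \<open>i\<close> is split at its last arc, which comes from
  \<open>k\<close>. This recursion drives the row estimates below.\<close>

lemma block_chain_Suc:
  "block (chain S (Suc t)) i j = (\<Sum>k\<in>UNIV. S (Suc t) $ i $ k *\<^sub>R (Pr i ** block (chain S t) k j))"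
proof -
  have "block (block_diagonal Pr ** (S (Suc t) \<otimes>\<^sub>K mat 1)) i k = S (Suc t) $ i $ k *\<^sub>R Pr i" for k
    unfolding block_mult block_block_diagonal block_kronecker
    by (subst sum.remove[of UNIV i]) (auto intro!: sum.neutral simp: matrix_mult_scaleR_right)
  then show ?thesis
    by (simp only: projected_chain.simps block_mult[of "_ ** _"] matrix_mult_scaleR_left)
qed

end

section \<open>Row estimates and walks through all vertices\<close>

context projection_family
begin

text \<open>Projections do not increase norms and the weights are nonnegative. The family
  \<open>X\<close> is arbitrary so that the estimate applies to the blocks of a chain and also to
  what is left of them after one walk is removed.\<close>

lemma row_sum_averaging:
  assumes "stochastic_matrix A"
  shows "(\<Sum>j\<in>J. matrix_two_norm (\<Sum>k\<in>UNIV. A $ i $ k *\<^sub>R (Pr i ** X k j))) \<le>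
    (\<Sum>k\<in>UNIV. A $ i $ k * (\<Sum>j\<in>J. matrix_two_norm (X k j)))"
proof -
  have nonneg: "0 \<le> A $ i $ k" for k
    using assms by (simp add: stochastic_matrix_def)
  have "matrix_two_norm (Pr i ** X k j) \<le> matrix_two_norm (X k j)" for k j
    using matrix_two_norm_mult[of "Pr i" "X k j"] matrix_two_norm_projection[of i]
      mult_right_mono[OF matrix_two_norm_projection[of i], of "matrix_two_norm (X k j)"] by simp
  then have "matrix_two_norm (A $ i $ k *\<^sub>R (Pr i ** X k j)) \<le> A $ i $ k * matrix_two_norm (X k j)" for k j
    by (simp add: matrix_two_norm_scaleR nonneg mult_left_mono)
  then have "(\<Sum>j\<in>J. matrix_two_norm (\<Sum>k\<in>UNIV. A $ i $ k *\<^sub>R (Pr i ** X k j))) \<le>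
      (\<Sum>j\<in>J. \<Sum>k\<in>UNIV. A $ i $ k * matrix_two_norm (X k j))"
    by (intro sum_mono order_trans[OF matrix_two_norm_sum])
  also have "\<dots> = (\<Sum>k\<in>UNIV. A $ i $ k * (\<Sum>j\<in>J. matrix_two_norm (X k j)))"
    unfolding sum_distrib_left by (rule sum.swap)
  finally show ?thesis .
qed

text \<open>Initially row \<open>i\<close> holds only \<open>Pr i\<close>; each later row norm is at
  most an average of earlier ones, with weights adding up to 1.\<close>

lemma block_row_norm_chain_le_one:
  assumes "\<And>k. 1 \<le> k \<Longrightarrow> stochastic_matrix (S k)"
  shows "block_row_norm (chain S t) i \<le> 1"
proof (induction t arbitrary: i)
  case 0
  have "block_row_norm (block_diagonal Pr) i = matrix_two_norm (Pr i)"
    unfolding block_row_norm_def block_block_diagonal by (simp add: if_distrib[of matrix_two_norm] cong: if_cong)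
  then show ?case
    using matrix_two_norm_projection[of i] by simp
next
  case (Suc t)
  have st: "stochastic_matrix (S (Suc t))"
    using assms by simp
  have "block_row_norm (chain S (Suc t)) i \<le>
      (\<Sum>k\<in>UNIV. S (Suc t) $ i $ k * block_row_norm (chain S t) k)"
    unfolding block_row_norm_def block_chain_Suc by (rule row_sum_averaging[OF st])
  also have "\<dots> \<le> (\<Sum>k\<in>UNIV. S (Suc t) $ i $ k * 1)"
    using st by (intro sum_mono mult_left_mono Suc.IH) (simp add: stochastic_matrix_def)
  also have "\<dots> = 1"
    using st by (simp add: stochastic_matrix_def)
  finally show ?case .
qed

lemma mixed_norm_chain_le_one:
  "(\<And>k. 1 \<le> k \<Longrightarrow> stochastic_matrix (S k)) \<Longrightarrow> mixed_norm (chain S t) \<le> 1"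
  by (simp add: mixed_norm_le_iff block_row_norm_chain_le_one)

text \<open>Expanding the \<open>i\<close>th block row of \<open>chain S t\<close> gives one term for each walk of length \<open>t\<close>
  ending at \<open>i\<close>: its weight times the product of the projections met along the walk. \<open>covers S t i V\<close>
  singles out one walk, from \<open>v\<close> and through all of \<open>V\<close>, with weight \<open>w\<close> and product \<open>M\<close>; the
  remaining walks contribute at most \<open>1 - w\<close>.\<close>

definition covers :: "(nat \<Rightarrow> real ^ 'm ^ 'm) \<Rightarrow> nat \<Rightarrow> 'm \<Rightarrow> 'm set \<Rightarrow> bool" where
  "covers S t i V \<longleftrightarrow> (\<exists>w M v. 0 < w \<and>
     (\<Sum>j\<in>UNIV. matrix_two_norm (block (chain S t) i j - (if j = v then w *\<^sub>R M else 0))) \<le> 1 - w \<and>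
     (\<forall>x. norm (M *v x) \<le> norm x \<and>
       (norm (M *v x) = norm x \<longrightarrow> M *v x = x \<and> (\<forall>u\<in>V. Pr u *v x = x))))"

lemma covers_mono: "covers S t i V \<Longrightarrow> U \<subseteq> V \<Longrightarrow> covers S t i U"
  unfolding covers_def by blast

lemma covers_0: "covers S 0 i {i}"
proof -
  have "(\<Sum>j\<in>UNIV. matrix_two_norm (block (chain S 0) i j - (if j = i then 1 *\<^sub>R Pr i else 0))) \<le> 1 - 1"
    unfolding projected_chain.simps block_block_diagonal by (simp add: eq_commute[of i] cong: if_cong)
  then show ?thesis
    unfolding covers_def using orthogonal_projection_norm[OF projection[of i]]
    by (intro exI[of _ 1] exI[of _ "Pr i"] exI[of _ i] conjI allI impI ballI) auto
qed

text \<open>The singled-out walk is prolonged by the arc from \<open>i\<close> to \<open>j\<close>: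
  its weight is multiplied by the entry of that arc and its product by \<open>Pr j\<close>, while
  its start \<open>v\<close> stays.\<close>

lemma covers_Suc:
  assumes st: "\<And>k. 1 \<le> k \<Longrightarrow> stochastic_matrix (S k)"
    and cov: "covers S t i V" and pos: "S (Suc t) $ j $ i \<noteq> 0"
  shows "covers S (Suc t) j (insert j V)"
proof -
  define A where "A = S (Suc t)"
  have A: "stochastic_matrix A"
    using st by (simp add: A_def)
  from cov obtain w M v where w: "0 < w"
    and rest: "(\<Sum>j\<in>UNIV. matrix_two_norm (block (chain S t) i j - (if j = v then w *\<^sub>R M else 0))) \<le> 1 - w"
    and M: "\<And>x. norm (M *v x) \<le> norm x"
      "\<And>x. norm (M *v x) = norm x \<Longrightarrow> M *v x = x \<and> (\<forall>u\<in>V. Pr u *v x = x)"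
    unfolding covers_def by blast
  \<comment> \<open>The previous blocks, with the singled-out walk removed from block
    (\<open>i\<close>, \<open>v\<close>).\<close>
  define X where "X = (\<lambda>k h. block (chain S t) k h - (if k = i \<and> h = v then w *\<^sub>R M else 0))"
  have X: "(\<Sum>h\<in>UNIV. matrix_two_norm (X k h)) \<le> 1 - (if k = i then w else 0)" for k
    using rest block_row_norm_chain_le_one[of S t k, OF st]
    by (simp add: X_def block_row_norm_def)
  have eq: "block (chain S (Suc t)) j h - (if h = v then (A $ j $ i * w) *\<^sub>R (Pr j ** M) else 0) =
      (\<Sum>k\<in>UNIV. A $ j $ k *\<^sub>R (Pr j ** X k h))" for h
  proof -
    have "A $ j $ k *\<^sub>R (Pr j ** X k h) = A $ j $ k *\<^sub>R (Pr j ** block (chain S t) k h) -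
        (if k = i then if h = v then (A $ j $ i * w) *\<^sub>R (Pr j ** M) else 0 else 0)" for k
      by (simp add: X_def matrix_mult_diff_right matrix_mult_scaleR_right scaleR_diff_right)
    then show ?thesis
      by (simp add: block_chain_Suc A_def sum_subtractf del: projected_chain.simps)
  qed
  have "(\<Sum>h\<in>UNIV. matrix_two_norm (block (chain S (Suc t)) j h -
        (if h = v then (A $ j $ i * w) *\<^sub>R (Pr j ** M) else 0))) \<le>
      (\<Sum>k\<in>UNIV. A $ j $ k * (\<Sum>h\<in>UNIV. matrix_two_norm (X k h)))"
    unfolding eq by (rule row_sum_averaging[OF A])
  \<comment> \<open>Only row \<open>i\<close> has lost the weight \<open>w\<close>, so the averaged
    bound drops by \<open>A $ j $ i * w\<close>.\<close>
  also have "\<dots> \<le> (\<Sum>k\<in>UNIV. A $ j $ k * (1 - (if k = i then w else 0)))"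
    using A by (intro sum_mono mult_left_mono X) (simp add: stochastic_matrix_def)
  also have "\<dots> = 1 - A $ j $ i * w"
    using A by (simp add: right_diff_distrib sum_subtractf stochastic_matrix_def if_distrib[of "\<lambda>x. _ * x"] cong: if_cong)
  finally have "(\<Sum>h\<in>UNIV. matrix_two_norm (block (chain S (Suc t)) j h -
        (if h = v then (A $ j $ i * w) *\<^sub>R (Pr j ** M) else 0))) \<le> 1 - A $ j $ i * w" .
  moreover have "0 < A $ j $ i * w"
    using A pos w by (simp add: A_def stochastic_matrix_def order_less_le)
  moreover have "norm ((Pr j ** M) *v x) \<le> norm x" for x
    using orthogonal_projection_norm(1)[OF projection[of j], of "M *v x"] M(1)[of x]
    by (simp flip: matrix_vector_mul_assoc)
  moreover have "(Pr j ** M) *v x = x \<and> (\<forall>u\<in>insert j V. Pr u *v x = x)"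
    if "norm ((Pr j ** M) *v x) = norm x" for x
  proof -
    have le: "norm (Pr j *v (M *v x)) \<le> norm (M *v x)"
      by (rule orthogonal_projection_norm(1)[OF projection])
    have eq: "norm (Pr j *v (M *v x)) = norm x"
      using that by (simp flip: matrix_vector_mul_assoc)
    have "norm (M *v x) = norm x"
      using le eq M(1)[of x] by simp
    moreover from this have "M *v x = x" and "\<forall>u\<in>V. Pr u *v x = x"
      using M(2) by auto
    moreover have "Pr j *v (M *v x) = M *v x"
      using eq \<open>norm (M *v x) = norm x\<close> by (intro orthogonal_projection_norm(2)[OF projection]) simp
    ultimately show ?thesis
      by (simp flip: matrix_vector_mul_assoc)
  qed
  ultimately show ?thesis
    unfolding covers_def by blast
qed

text \<open>A vector whose norm \<open>M\<close> preserves lies in every image and is therefore 0,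
  so \<open>M\<close> has norm below 1. The singled-out walk then contributes less than its weight
  \<open>w\<close>.\<close>

lemma block_row_norm_less_one:
  assumes "covers S t i UNIV" and trivial: "(\<Inter>i. matrix_image (Pr i)) = {0}"
  shows "block_row_norm (chain S t) i < 1"
proof -
  from assms(1) obtain w M v where w: "0 < w"
    and rest: "(\<Sum>j\<in>UNIV. matrix_two_norm (block (chain S t) i j - (if j = v then w *\<^sub>R M else 0))) \<le> 1 - w"
    and M: "\<And>x. norm (M *v x) \<le> norm x"
      "\<And>x. norm (M *v x) = norm x \<Longrightarrow> \<forall>u. Pr u *v x = x"
    unfolding covers_def by blast
  have "matrix_two_norm M < 1"
  proof (rule matrix_two_norm_less_one[OF M(1)])
    fix x assume "norm (M *v x) = norm x"
    then have "x \<in> (\<Inter>i. matrix_image (Pr i))"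
      using M(2)[of x] unfolding matrix_image_def by (metis INT_I rangeI)
    then show "x = 0"
      by (simp add: trivial)
  qed
  have "block_row_norm (chain S t) i \<le>
      (\<Sum>j\<in>UNIV. matrix_two_norm (block (chain S t) i j - (if j = v then w *\<^sub>R M else 0)) +
        matrix_two_norm (if j = v then w *\<^sub>R M else 0))"
    unfolding block_row_norm_def by (intro sum_mono) (metis diff_add_cancel matrix_two_norm_triangle)
  also have "\<dots> \<le> 1 - w + w * matrix_two_norm M"
    using rest w by (simp add: sum.distrib if_distrib[of matrix_two_norm] matrix_two_norm_scaleR cong: if_cong)
  also have "\<dots> < 1"
    using w \<open>matrix_two_norm M < 1\<close> by simp
  finally show ?thesis .
qed

end

subsection \<open>Compositions of strongly connected graphs\<close>

text \<open>Otherwise \<open>X\<close> would be closed under arcs, and \<open>b\<close>, being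
  reachable from \<open>a\<close>, would lie in it.\<close>

lemma strongly_connected_leaves:
  assumes sc: "strongly_connected (with_proj G)" and "pverts G = UNIV" and "a \<in> X" and "b \<notin> X"
  obtains i j where "(i, j) \<in> parcs G" "i \<in> X" "j \<notin> X"
proof -
  have reach: "(a, b) \<in> rtrancl_on UNIV (parcs G)"
    using sc assms(2) by (auto simp: strongly_connected_def reachable_def)
  have "b \<in> X" if "\<And>i j. (i, j) \<in> parcs G \<Longrightarrow> i \<in> X \<Longrightarrow> j \<in> X"
    using reach by (induction rule: rtrancl_on_induct) (use that \<open>a \<in> X\<close> in auto)
  then show thesis
    using that \<open>b \<notin> X\<close> by blast
qed

text \<open>Self-arcs keep every vertex already reached, and strong connectivity adds a new one at
  each step until none is left. The predicate \<open>A\<close> is arbitrary so that it can also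
  carry a set of visited vertices.\<close>

lemma reachable_set_grows:
  fixes A :: "nat \<Rightarrow> 'm::finite \<Rightarrow> bool"
  assumes sc: "\<And>b. strongly_connected (with_proj (G b))"
    and self: "\<And>b. G b \<in> self_arc_graphs"
    and start: "A b i"
    and step: "\<And>b i j. A b i \<Longrightarrow> (i, j) \<in> parcs (G b) \<Longrightarrow> A (Suc b) j"
  shows "A (b + (CARD('m) - 1)) j"
proof -
  \<comment> \<open>The minimum expresses growth by one per step, saturating at the full vertex
    set.\<close>
  have "min CARD('m) (Suc c) \<le> card {j. A (b + c) j}" for c
  proof (induction c)
    case 0
    have "card {i} \<le> card {j. A b j}"
      using start by (intro card_mono) auto
    then show ?case
      by simp
  next
    case (Suc c)
    let ?X = "{j. A (b + c) j}" and ?Y = "{j. A (b + Suc c) j}"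
    have sub: "?X \<subseteq> ?Y"
      using step self unfolding self_arc_graphs_def by fastforce
    show ?case
    proof (cases "?X = UNIV")
      case True
      then have "?Y = UNIV"
        using sub by auto
      then show ?thesis
        by simp
    next
      case False
      have "?X \<noteq> {}"
      proof
        assume "?X = {}"
        then show False
          using Suc.IH by (simp add: min_def split: if_splits)
      qed
      then obtain p q where "(p, q) \<in> parcs (G (b + c))" "p \<in> ?X" "q \<notin> ?X"
        using False strongly_connected_leaves[OF sc[of "b + c"], of _ ?X] self[of "b + c"]
        unfolding self_arc_graphs_def by blast
      then have "q \<in> ?Y - ?X"
        using step by auto
      then have "card ?X < card ?Y"
        using sub by (intro psubset_card_mono) auto
      then show ?thesis
        using Suc.IH by linarith
    qed
  qed
  from this[of "CARD('m) - 1"] have "CARD('m) \<le> card {j. A (b + (CARD('m) - 1)) j}"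
    by simp
  then have "{j. A (b + (CARD('m) - 1)) j} = UNIV"
    by (intro card_seteq) auto
  then show ?thesis
    by auto
qed

text \<open>After each round of \<open>CARD('m) - 1\<close> strongly connected graphs every vertex is reachable from
  every other one, so a walk can visit the vertices of \<open>V\<close> one per round, in any order.\<close>

lemma walk_covers:
  fixes A :: "nat \<Rightarrow> 'm::finite \<Rightarrow> 'm set \<Rightarrow> bool"
  assumes sc: "\<And>b. strongly_connected (with_proj (G b))"
    and self: "\<And>b. G b \<in> self_arc_graphs"
    and start: "\<And>i. A 0 i {i}"
    and step: "\<And>b i j V. A b i V \<Longrightarrow> i \<in> V \<Longrightarrow> (i, j) \<in> parcs (G b) \<Longrightarrow> A (Suc b) j (insert j V)"
    and mono: "\<And>b i U V. A b i V \<Longrightarrow> U \<subseteq> V \<Longrightarrow> A b i U"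
  shows "A ((CARD('m) - 1)\<^sup>2) i UNIV"
proof -
  let ?m = "CARD('m) - 1"
  \<comment> \<open>One round leads from \<open>i\<close> to any \<open>j\<close>; the vertices
    passed on the way are forgotten through \<open>mono\<close>.\<close>
  have walk: "A (b + ?m) j (insert j V)" if "A b i V" "i \<in> V" for b i j V
  proof (rule reachable_set_grows[where A = "\<lambda>b j. A b j (insert j V)", OF sc self])
    show "A b i (insert i V)"
      using that by (simp add: insert_absorb)
    fix b i j assume "A b i (insert i V)" and "(i, j) \<in> parcs (G b)"
    then have "A (Suc b) j (insert j (insert i V))"
      by (intro step) auto
    then show "A (Suc b) j (insert j V)"
      by (rule mono) auto
  qed
  \<comment> \<open>\<open>p\<close> rounds visit \<open>p + 1\<close> vertices because the start
    counts as visited. The last round ends at \<open>i\<close>; the one before may end at any other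
    vertex of \<open>V\<close>, or at \<open>i\<close> itself if there is none.\<close>
  have "A (p * ?m) i V" if "card V \<le> Suc p" "i \<in> V" for p i V
    using that
  proof (induction p arbitrary: i V)
    case 0
    then have "V = {i}"
      by (metis card_1_singletonE card_eq_0_iff finite_code le_SucE le_zero_eq One_nat_def singletonD empty_iff)
    then show ?case
      using start by simp
  next
    case (Suc p)
    show ?case
    proof (cases "V = {i}")
      case True
      then have "A (p * ?m) i V"
        by (intro Suc.IH) auto
      from walk[OF this \<open>i \<in> V\<close>, of i] True show ?thesis
        by (simp add: add.commute)
    next
      case False
      then obtain h where h: "h \<in> V - {i}"
        using Suc.prems by auto
      then have "A (p * ?m) h (V - {i})"
        using Suc.prems by (intro Suc.IH) auto
      from walk[OF this h, of i] Suc.prems show ?thesis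
        by (simp add: add.commute insert_absorb)
    qed
  qed
  from this[of UNIV ?m i] show ?thesis
    by (simp add: power2_eq_square)
qed

subsection \<open>Graphs of matrix products\<close>

definition nonneg_matrix :: "real ^ 'm ^ 'm \<Rightarrow> bool" where
  "nonneg_matrix A \<longleftrightarrow> (\<forall>i j. 0 \<le> A $ i $ j)"

lemma stochastic_nonneg: "stochastic_matrix A \<Longrightarrow> nonneg_matrix A"
  by (simp add: stochastic_matrix_def nonneg_matrix_def)

lemma nonneg_matrix_mult: "nonneg_matrix A \<Longrightarrow> nonneg_matrix B \<Longrightarrow> nonneg_matrix (A ** B)"
  by (simp add: nonneg_matrix_def matrix_matrix_mult_def sum_nonneg)

lemma nonneg_matrix_chain:
  "(\<And>k. 1 \<le> k \<Longrightarrow> nonneg_matrix (S k)) \<Longrightarrow> nonneg_matrix (matrix_chain S t)"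
proof (induction t)
  case 0
  show ?case
    by (simp add: nonneg_matrix_def mat_def)
qed (auto intro: nonneg_matrix_mult)

text \<open>Nonnegative terms cannot cancel, so the sum vanishes only if each of its terms
  does.\<close>

lemma nonneg_matrix_mult_neq_0_iff:
  assumes "nonneg_matrix A" and "nonneg_matrix B"
  shows "(A ** B) $ i $ j \<noteq> 0 \<longleftrightarrow> (\<exists>k. A $ i $ k \<noteq> 0 \<and> B $ k $ j \<noteq> 0)"
proof -
  have "0 \<le> A $ i $ k * B $ k $ j" for k
    using assms by (simp add: nonneg_matrix_def)
  then show ?thesis
    by (simp add: matrix_matrix_mult_def sum_nonneg_eq_0_iff)
qed

lemma matrix_graph_mult:
  assumes "nonneg_matrix A" and "nonneg_matrix B"
  shows "matrix_graph (A ** B) = matrix_graph A \<circ>\<^sub>G matrix_graph B"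
  using nonneg_matrix_mult_neq_0_iff[OF assms]
  by (auto simp: matrix_graph_def graph_comp_def)

text \<open>A chain of graphs starts at a given index and has one factor more than its counter,
  while a chain of matrices starts at index 1: hence the shift by \<open>s\<close> and the two
  successors.\<close>

lemma graph_chain_matrix_graph:
  assumes "\<And>k. 1 \<le> k \<Longrightarrow> nonneg_matrix (S k)"
  shows "graph_chain (\<lambda>t. matrix_graph (S t)) (Suc s) c =
    matrix_graph (matrix_chain (\<lambda>k. S (s + k)) (Suc c))"
proof (induction c)
  case (Suc c)
  have "matrix_graph (matrix_chain (\<lambda>k. S (s + k)) (Suc (Suc c))) =
      matrix_graph (S (s + Suc (Suc c))) \<circ>\<^sub>G matrix_graph (matrix_chain (\<lambda>k. S (s + k)) (Suc c))"
    unfolding matrix_chain.simps(2)[of _ "Suc c"]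
    by (intro matrix_graph_mult nonneg_matrix_chain) (use assms in auto)
  with Suc show ?case
    by simp
qed simp

lemma matrix_chain_self_arcs:
  assumes nonneg: "\<And>k. 1 \<le> k \<Longrightarrow> nonneg_matrix (S k)"
    and self: "\<And>k. 1 \<le> k \<Longrightarrow> matrix_graph (S k) \<in> self_arc_graphs"
  shows "matrix_graph (matrix_chain S t) \<in> self_arc_graphs"
proof (induction t)
  case 0
  show ?case
    by (simp add: matrix_graph_def self_arc_graphs_def mat_def)
next
  case (Suc t)
  have "matrix_graph (S (Suc t) ** matrix_chain S t) =
      matrix_graph (S (Suc t)) \<circ>\<^sub>G matrix_graph (matrix_chain S t)"
    using nonneg by (intro matrix_graph_mult nonneg_matrix_chain) auto
  with Suc self[of "Suc t"] show ?case
    by (auto simp: self_arc_graphs_def graph_comp_def)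
qed

context projection_family
begin

text \<open>An arc in the graph of a product is a path through the arcs of its factors, along which
  \<open>covers_Suc\<close> applies; the intermediate vertices are dropped.\<close>

lemma covers_matrix_chain:
  assumes st: "\<And>k. 1 \<le> k \<Longrightarrow> stochastic_matrix (S k)"
    and cov: "covers S t i V" "i \<in> V"
    and "matrix_chain (\<lambda>k. S (t + k)) c $ j $ i \<noteq> 0"
  shows "covers S (t + c) j (insert j V)"
  using assms(4)
proof (induction c arbitrary: j)
  case 0
  then have "j = i"
    by (simp add: mat_def split: if_splits)
  with cov show ?case
    by (simp add: insert_absorb)
next
  case (Suc c)
  have "nonneg_matrix (S (t + Suc c))" "nonneg_matrix (matrix_chain (\<lambda>k. S (t + k)) c)"
    using st by (auto intro!: stochastic_nonneg nonneg_matrix_chain)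
  with Suc.prems obtain h where h: "S (Suc (t + c)) $ j $ h \<noteq> 0" "matrix_chain (\<lambda>k. S (t + k)) c $ h $ i \<noteq> 0"
    by (auto simp: nonneg_matrix_mult_neq_0_iff)
  have "covers S (Suc (t + c)) j (insert j (insert h V))"
    using Suc.IH[OF h(2)] h(1) by (intro covers_Suc st) auto
  then show ?case
    unfolding add_Suc_right by (rule covers_mono) auto
qed

text \<open>Time is counted in blocks of length \<open>l\<close>, each of which acts in
  \<open>walk_covers\<close> as one strongly connected graph.\<close>

lemma mixed_norm_chain_less_one:
  assumes trivial: "(\<Inter>i. matrix_image (Pr i)) = {0}"
    and st: "\<And>k. 1 \<le> k \<Longrightarrow> stochastic_matrix (S k)"
    and self: "\<And>k. 1 \<le> k \<Longrightarrow> matrix_graph (S k) \<in> self_arc_graphs"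
    and sc: "\<And>b. strongly_connected (with_proj (matrix_graph (matrix_chain (\<lambda>k. S (b * l + k)) l)))"
  shows "mixed_norm (chain S ((CARD('m) - 1)\<^sup>2 * l)) < 1"
proof -
  have "covers S ((CARD('m) - 1)\<^sup>2 * l) i UNIV" for i
  proof (rule walk_covers[of "\<lambda>b. matrix_graph (matrix_chain (\<lambda>k. S (b * l + k)) l)"
        "\<lambda>b. covers S (b * l)", OF sc])
    show "matrix_graph (matrix_chain (\<lambda>k. S (b * l + k)) l) \<in> self_arc_graphs" for b
      using st self by (intro matrix_chain_self_arcs) (auto intro: stochastic_nonneg)
    show "covers S (0 * l) i {i}" for i
      by (simp add: covers_0)
    show "covers S (b * l) i U" if "covers S (b * l) i V" "U \<subseteq> V" for b i U V
      using that by (rule covers_mono)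
    show "covers S (Suc b * l) j (insert j V)"
      if "covers S (b * l) i V" "i \<in> V" "(i, j) \<in> parcs (matrix_graph (matrix_chain (\<lambda>k. S (b * l + k)) l))"
      for b i j V
      using covers_matrix_chain[OF st that(1,2), of l j] that(3)
      by (simp add: matrix_graph_def add.commute)
  qed
  then have "block_row_norm (chain S ((CARD('m) - 1)\<^sup>2 * l)) i < 1" for i
    by (rule block_row_norm_less_one[OF _ trivial])
  then show ?thesis
    unfolding mixed_norm_eq by (subst Max_less_iff) auto
qed

end

subsection \<open>Compactness\<close>

text \<open>Reduces continuity on an abstract topology to limits at points, where the limit rules
  for matrices apply.\<close>

lemma continuous_map_euclideanI:
  assumes "\<And>x. x \<in> topspace X \<Longrightarrow> (f \<longlongrightarrow> f x) (atin X x)"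
  shows "continuous_map X euclidean f"
  using assms by (simp add: continuous_map_atin)

lemma continuous_map_euclideanD:
  "continuous_map X euclidean f \<Longrightarrow> x \<in> topspace X \<Longrightarrow> (f \<longlongrightarrow> f x) (atin X x)"
  by (simp add: continuous_map_atin)

lemma tendsto_matrix_matrix_mult:
  fixes f g :: "'a \<Rightarrow> real ^ 'k ^ 'k"
  assumes "(f \<longlongrightarrow> A) F" "(g \<longlongrightarrow> B) F"
  shows "((\<lambda>x. f x ** g x) \<longlongrightarrow> A ** B) F"
  unfolding matrix_matrix_mult_def by (intro tendsto_intros assms)

lemma tendsto_kronecker:
  assumes "(f \<longlongrightarrow> A) F"
  shows "((\<lambda>x. f x \<otimes>\<^sub>K B) \<longlongrightarrow> A \<otimes>\<^sub>K B) F"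
  unfolding kronecker_def by (intro tendsto_intros assms)

lemma continuous_map_projected_chain:
  fixes P :: "real ^ ('m::finite \<times> 'n::finite) ^ ('m \<times> 'n)"
  assumes "\<And>k. 1 \<le> k \<Longrightarrow> k \<le> t \<Longrightarrow> continuous_map X euclidean (\<lambda>x. f x k)"
  shows "continuous_map X euclidean (\<lambda>x. projected_chain P (f x) t)"
  using assms
proof (induction t)
  case (Suc t)
  have "continuous_map X euclidean (\<lambda>x. projected_chain P (f x) t)"
    and "continuous_map X euclidean (\<lambda>x. f x (Suc t))"
    using Suc by auto
  then show ?case
    by (auto intro!: continuous_map_euclideanI tendsto_matrix_matrix_mult tendsto_kronecker
        tendsto_const dest: continuous_map_euclideanD)
qed simp

lemma continuous_map_block_row_norm:
  assumes "continuous_map X euclidean f"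
  shows "continuous_map X euclidean (\<lambda>x. block_row_norm (f x) i)"
proof (rule continuous_map_euclideanI)
  fix x assume "x \<in> topspace X"
  then have "(f \<longlongrightarrow> f x) (atin X x)"
    by (rule continuous_map_euclideanD[OF assms])
  then show "((\<lambda>y. block_row_norm (f y) i) \<longlongrightarrow> block_row_norm (f x) i) (atin X x)"
    unfolding block_row_norm_def block_def
    by (intro tendsto_sum tendsto_matrix_two_norm tendsto_vec_lambda tendsto_vec_nth)
qed

text \<open>A continuous function attains its maximum on a nonempty compact set, so strictness
  becomes uniform; the finitely many indices \<open>i\<close> share the largest constant.\<close>

lemma compactin_less_uniform:
  fixes f :: "'i::finite \<Rightarrow> 'a \<Rightarrow> real"
  assumes K: "compactin X K"
    and cont: "\<And>i. continuous_map X euclidean (f i)"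
    and less: "\<And>i x. x \<in> K \<Longrightarrow> f i x < b"
  obtains c where "c < b" "\<And>i x. x \<in> K \<Longrightarrow> f i x \<le> c"
proof -
  have "\<exists>c<b. \<forall>x\<in>K. f i x \<le> c" for i
  proof (cases "K = {}")
    case True
    then show ?thesis
      using lt_ex by auto
  next
    case False
    have "compact (f i ` K)"
      using image_compactin[OF K cont] by simp
    then show ?thesis
      using compact_attains_sup[of "f i ` K"] False less by fastforce
  qed
  then obtain c where c: "\<And>i. c i < b" "\<And>i x. x \<in> K \<Longrightarrow> f i x \<le> c i"
    by metis
  show thesis
  proof
    show "Max (range c) < b"
      using c(1) by (subst Max_less_iff) auto
    show "f i x \<le> Max (range c)" if "x \<in> K" for i x
      using c(2)[OF that, of i] by (rule order_trans) auto
  qed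
qed

lemma iterated_sup_le:
  assumes "A \<noteq> {}" and "\<And>hs. length hs = k \<Longrightarrow> set hs \<subseteq> A \<Longrightarrow> F hs \<le> c"
  shows "iterated_sup A k F \<le> c"
  using assms(2)
proof (induction k arbitrary: F)
  case (Suc k)
  then show ?case
    by (auto intro!: cSUP_least assms(1) Suc.IH)
qed simp

text \<open>The bound \<open>c\<close> keeps every real supremum bounded above. The outermost
  supremum runs over the last element, so the list is split at its end.\<close>

lemma iterated_sup_upper:
  assumes "\<And>hs. length hs = k \<Longrightarrow> set hs \<subseteq> A \<Longrightarrow> F hs \<le> c"
    and "length hs = k" "set hs \<subseteq> A"
  shows "F hs \<le> iterated_sup A k F"
  using assms
proof (induction k arbitrary: F hs)
  case (Suc k)
  from Suc.prems(2) obtain gs h where hs: "hs = gs @ [h]" "length gs = k"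
    by (metis length_Suc_conv_rev)
  with Suc.prems(3) have gs: "set gs \<subseteq> A" "h \<in> A"
    by auto
  have "F hs \<le> iterated_sup A k (\<lambda>hs. F (hs @ [h]))"
    unfolding hs(1) using hs gs by (intro Suc.IH[where F = "\<lambda>hs. F (hs @ [h])"] Suc.prems(1)) auto
  also have "\<dots> \<le> iterated_sup A (Suc k) F"
    unfolding iterated_sup.simps
  proof (rule cSUP_upper[OF gs(2)])
    have "iterated_sup A k (\<lambda>hs. F (hs @ [h])) \<le> c" if "h \<in> A" for h
      using that by (intro iterated_sup_le Suc.prems(1)) auto
    then show "bdd_above ((\<lambda>h. iterated_sup A k (\<lambda>hs. F (hs @ [h]))) ` A)"
      by (intro bdd_aboveI2)
  qed
  finally show ?case .
qed simp

subsection \<open>Geometric decay\<close>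

text \<open>Powers of a base in [0, 1] decrease with the exponent. For negative \<open>e\<close> the
  right side is at least 1, and infinite if \<open>x\<close> is 0.\<close>

lemma power_le_ereal_powi:
  assumes "0 \<le> x" "x \<le> 1" "e \<le> int n"
  shows "ereal (x ^ n) \<le> ereal_powi x e"
proof (cases "e < 0")
  case True
  have "x ^ n \<le> x powi e" if "x \<noteq> 0"
  proof -
    have "x ^ n \<le> 1"
      using assms by (simp add: power_le_one)
    also have "1 \<le> inverse x ^ nat (- e)"
      using that assms by (intro one_le_power) (simp add: one_le_inverse)
    finally show ?thesis
      using True by (simp add: power_int_def)
  qed
  with True show ?thesis
    by (simp add: ereal_powi_def)
next
  case False
  then have "x ^ n \<le> x ^ nat e"
    using assms by (intro power_decreasing) auto
  with False show ?thesis
    by (simp add: ereal_powi_def power_int_def)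
qed

text \<open>Like \<open>concatenated\<close>, but with the blocks indexed by a function, so that
  families of blocks are points of a product space.\<close>

definition joined :: "nat \<Rightarrow> (nat \<Rightarrow> nat \<Rightarrow> 'a) \<Rightarrow> nat \<Rightarrow> 'a" where
  "joined l H k = H ((k - 1) div l) ((k - 1) mod l + 1)"

lemma joined_add: "1 \<le> k \<Longrightarrow> k \<le> l \<Longrightarrow> joined l H (b * l + k) = H b k"
  by (cases k) (simp_all add: joined_def)

lemma joined_index_less:
  fixes k l n :: nat
  assumes "1 \<le> k" "k \<le> n * l"
  shows "(k - 1) div l < n"
proof -
  have "k - 1 < n * l" "l > 0"
    using assms by (auto intro: gr0I)
  then show ?thesis
    by (simp add: div_less_iff_less_mult)
qed

section \<open>Uniform contraction over one period of \<omega> blocks\<close>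

locale compact_projection_family = projection_family Pr
  for Pr :: "'m::finite \<Rightarrow> real ^ 'n::finite ^ 'n" +
  fixes C :: "(real ^ 'm ^ 'm) set" and l \<omega> :: nat
  assumes several: "CARD('m) > 1"
    and trivial_intersection: "(\<Inter>i. matrix_image (Pr i)) = {0}"
    and l_pos: "l > 0"
    and compact: "l_compact l C"
    and \<omega>_eq: "\<omega> = (CARD('m) - 1)\<^sup>2"
begin

lemma \<omega>_pos: "\<omega> > 0"
  using several by (simp add: \<omega>_eq)

lemma stochastic: "A \<in> C \<Longrightarrow> stochastic_matrix A"
  and self_arcs: "A \<in> C \<Longrightarrow> matrix_graph A \<in> self_arc_graphs"
  using compact by (auto simp: l_compact_def)

lemma connected_sequences_in: "H \<in> connected_sequences l C \<Longrightarrow> 1 \<le> k \<Longrightarrow> k \<le> l \<Longrightarrow> H k \<in> C"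
  by (auto simp: connected_sequences_def)

lemma mixed_norm_joined_less_one:
  assumes H: "\<And>b. H b \<in> connected_sequences l C"
  shows "mixed_norm (chain (joined l H) (\<omega> * l)) < 1"
unfolding \<omega>_eq
proof (rule mixed_norm_chain_less_one[OF trivial_intersection])
  have "joined l H k \<in> C" for k
    unfolding joined_def using l_pos by (intro connected_sequences_in H) (simp_all add: Suc_leI)
  then show "stochastic_matrix (joined l H k)" "matrix_graph (joined l H k) \<in> self_arc_graphs" for k
    using stochastic self_arcs by auto
  have "matrix_chain (\<lambda>k. joined l H (b * l + k)) l = matrix_chain (H b) l" for b
    by (intro matrix_chain_cong joined_add)
  then show "strongly_connected (with_proj (matrix_graph (matrix_chain (\<lambda>k. joined l H (b * l + k)) l)))" for b
    using H[of b] by (simp add: connected_sequences_def)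
qed

text \<open>The families of \<omega> connected blocks form a compact set by Tychonoff's theorem, and
  every row norm is continuous and below 1 on it.\<close>

lemma contraction_constant:
  obtains c where "c < 1"
    "\<And>H. (\<And>b. b < \<omega> \<Longrightarrow> H b \<in> connected_sequences l C) \<Longrightarrow> mixed_norm (chain (joined l H) (\<omega> * l)) \<le> c"
proof -
  let ?A = "connected_sequences l C"
  let ?X = "product_topology (\<lambda>_. product_topology (\<lambda>_. euclidean) {1..l}) {..<\<omega>}
    :: (nat \<Rightarrow> nat \<Rightarrow> real ^ 'm ^ 'm) topology"
  let ?f = "\<lambda>i H. block_row_norm (chain (joined l H) (\<omega> * l)) i"
  have cong: "chain (joined l H) (\<omega> * l) = chain (joined l G) (\<omega> * l)"
    if "\<And>b. b < \<omega> \<Longrightarrow> H b = G b" for H G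
    unfolding joined_def
    by (intro projected_chain_cong) (simp only: that joined_index_less)
  have "compactin ?X ({..<\<omega>} \<rightarrow>\<^sub>E ?A)"
    using compact by (simp add: compactin_PiE l_compact_def)
  moreover have "continuous_map ?X euclidean (?f i)" for i
  proof (intro continuous_map_block_row_norm continuous_map_projected_chain)
    fix k assume "1 \<le> k" "k \<le> \<omega> * l"
    then have b: "(k - 1) div l \<in> {..<\<omega>}"
      by (simp only: joined_index_less lessThan_iff)
    have r: "(k - 1) mod l + 1 \<in> {1..l}"
      using l_pos by (simp add: Suc_leI)
    show "continuous_map ?X euclidean (\<lambda>H. joined l H k)"
      unfolding joined_def
      using continuous_map_compose[OF continuous_map_product_projection[OF b]
          continuous_map_product_projection[OF r]] by (simp add: o_def)
  qed
  moreover have "?f i H < 1" if "H \<in> {..<\<omega>} \<rightarrow>\<^sub>E ?A" for i H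
  proof -
    \<comment> \<open>\<open>mixed_norm_joined_less_one\<close> asks for connected blocks at every
      index, so block 0 is repeated from index \<omega> on; the chain of length
      \<open>\<omega> * l\<close> does not see this.\<close>
    let ?G = "\<lambda>b. H (if b < \<omega> then b else 0)"
    have "mixed_norm (chain (joined l ?G) (\<omega> * l)) < 1"
      using that \<omega>_pos by (intro mixed_norm_joined_less_one) auto
    also have "chain (joined l ?G) (\<omega> * l) = chain (joined l H) (\<omega> * l)"
      by (intro cong) simp
    finally show ?thesis
      using block_row_norm_le_mixed_norm le_less_trans by blast
  qed
  ultimately have "\<exists>c<1. \<forall>i. \<forall>H\<in>{..<\<omega>} \<rightarrow>\<^sub>E ?A. ?f i H \<le> c"
    by (rule compactin_less_uniform[where f = ?f]) blast+
  then obtain c where c: "c < 1" "\<And>i H. H \<in> {..<\<omega>} \<rightarrow>\<^sub>E ?A \<Longrightarrow> ?f i H \<le> c"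
    by blast
  show thesis
  proof
    fix H :: "nat \<Rightarrow> nat \<Rightarrow> real ^ 'm ^ 'm"
    assume H: "\<And>b. b < \<omega> \<Longrightarrow> H b \<in> ?A"
    \<comment> \<open>Points of the product space are \<open>undefined\<close> off the index set, so
      \<open>H\<close> is restricted; the chain stays the same.\<close>
    have "chain (joined l H) (\<omega> * l) = chain (joined l (restrict H {..<\<omega>})) (\<omega> * l)"
      by (intro cong) simp
    then show "mixed_norm (chain (joined l H) (\<omega> * l)) \<le> c"
      using c(2)[of "restrict H {..<\<omega>}"] H by (simp add: mixed_norm_le_iff)
  qed (fact c(1))
qed

text \<open>This is \<lambda> to the power \<open>\<omega> * l\<close>; the root is taken only in
  the theorem.\<close>

definition "rate_power = iterated_sup (connected_sequences l C) \<omega>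
  (\<lambda>hs. mixed_norm (chain (concatenated l hs) (\<omega> * l)))"

text \<open>A supremum of numbers below 1 may equal 1, so the uniform constant of
  \<open>contraction_constant\<close> is used. Nonnegativity follows by comparison with one actual
  norm.\<close>

lemma rate_power:
  shows rate_power_nonneg: "0 \<le> rate_power"
    and rate_power_less_one: "rate_power < 1"
    and rate_power_upper: "length hs = \<omega> \<Longrightarrow> set hs \<subseteq> connected_sequences l C \<Longrightarrow>
      mixed_norm (chain (concatenated l hs) (\<omega> * l)) \<le> rate_power"
proof -
  let ?A = "connected_sequences l C"
  have joined: "concatenated l hs = joined l (\<lambda>b. hs ! b)" for hs :: "(nat \<Rightarrow> real ^ 'm ^ 'm) list"
    by (simp add: fun_eq_iff concatenated_def joined_def)
  obtain c where c: "c < 1"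
    "\<And>H. (\<And>b. b < \<omega> \<Longrightarrow> H b \<in> ?A) \<Longrightarrow> mixed_norm (chain (joined l H) (\<omega> * l)) \<le> c"
    using contraction_constant by blast
  have le: "mixed_norm (chain (concatenated l hs) (\<omega> * l)) \<le> c"
    if "length hs = \<omega>" "set hs \<subseteq> ?A" for hs
    unfolding joined using that by (intro c(2)) (auto simp: subset_iff)
  have nonempty: "?A \<noteq> {}"
    using compact by (simp add: l_compact_def)
  show "rate_power < 1"
    unfolding rate_power_def using le c(1) by (intro le_less_trans[OF iterated_sup_le[OF nonempty]])
  show upper: "mixed_norm (chain (concatenated l hs) (\<omega> * l)) \<le> rate_power"
    if "length hs = \<omega>" "set hs \<subseteq> ?A" for hs
    unfolding rate_power_def
    by (rule iterated_sup_upper[where F = "\<lambda>hs. mixed_norm (chain (concatenated l hs) (\<omega> * l))", OF le that])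
  obtain H where "H \<in> ?A"
    using nonempty by blast
  then have "mixed_norm (chain (concatenated l (replicate \<omega> H)) (\<omega> * l)) \<le> rate_power"
    by (intro upper) auto
  then show "0 \<le> rate_power"
    using mixed_norm_nonneg order_trans by blast
qed

text \<open>Each further period of \<omega> blocks is an admissible list for the nested suprema and
  contributes one factor \<open>rate_power\<close>.\<close>

lemma mixed_norm_chain_le_power:
  assumes "\<And>b. restrict (\<lambda>k. S (b * l + k)) {1..l} \<in> connected_sequences l C"
  shows "mixed_norm (chain S (q * (\<omega> * l))) \<le> rate_power ^ q"
proof (induction q)
  case 0
  show ?case
    \<comment> \<open>A chain of length 0 does not depend on its sequence, so constant identities
      serve.\<close>
    using mixed_norm_chain_le_one[of "\<lambda>_. mat 1" 0] by (simp add: stochastic_matrix_def mat_def)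
next
  case (Suc q)
  let ?T = "\<omega> * l"
  define hs where "hs = map (\<lambda>b. restrict (\<lambda>k. S ((q * \<omega> + b) * l + k)) {1..l}) [0..<\<omega>]"
  have "chain (\<lambda>k. S (q * ?T + k)) ?T = chain (concatenated l hs) ?T"
  proof (rule projected_chain_cong)
    fix k assume k: "1 \<le> k" "k \<le> ?T"
    have "(k - 1) mod l + 1 \<in> {1..l}"
      using l_pos by (simp add: Suc_leI)
    then have "concatenated l hs k = S ((q * \<omega> + (k - 1) div l) * l + ((k - 1) mod l + 1))"
      unfolding concatenated_def hs_def using joined_index_less[OF k] by simp
    also have "(q * \<omega> + (k - 1) div l) * l + ((k - 1) mod l + 1) = q * ?T + ((k - 1) div l * l + (k - 1) mod l) + 1"
      by (simp add: algebra_simps)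
    also have "\<dots> = q * ?T + k"
      using k by simp
    finally show "S (q * ?T + k) = concatenated l hs k"
      by simp
  qed
  moreover have "mixed_norm (chain (concatenated l hs) ?T) \<le> rate_power"
    using assms by (intro rate_power_upper) (auto simp: hs_def)
  ultimately have "mixed_norm (chain (\<lambda>k. S (q * ?T + k)) ?T) \<le> rate_power"
    by simp
  then have "mixed_norm (chain S (q * ?T + ?T)) \<le> rate_power * rate_power ^ q"
    unfolding chain_add
    by (intro order_trans[OF mixed_norm_mult] mult_mono Suc.IH rate_power_nonneg mixed_norm_nonneg)
  then show ?case
    by (simp add: add.commute)
qed

text \<open>The chain splits into \<open>s\<close> initial factors, \<open>q\<close> full periods
  and a remainder of \<open>r\<close> factors; the first and last pieces have norm at most 1. For
  \<open>t < s\<close> natural subtraction makes the exponent 0.\<close>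

lemma mixed_norm_chain_decay:
  assumes S: "\<And>t. 1 \<le> t \<Longrightarrow> S t \<in> C"
    and conn: "repeatedly_jointly_strongly_connected_from (Suc s) l (\<lambda>t. matrix_graph (S t))"
  shows "mixed_norm (chain S t) \<le> rate_power ^ ((t - s) div (\<omega> * l))"
proof -
  have st: "stochastic_matrix (S k)" if "1 \<le> k" for k
    using S stochastic that by blast
  show ?thesis
  proof (cases "s \<le> t")
    case False
    then show ?thesis
      using mixed_norm_chain_le_one[OF st] by simp
  next
    case True
    define T where "T = \<omega> * l"
    define q where "q = (t - s) div T"
    define r where "r = (t - s) mod T"
    have t: "t = (s + q * T) + r"
      using True by (simp add: q_def r_def)
    have blocks: "restrict (\<lambda>k. S (s + (b * l + k))) {1..l} \<in> connected_sequences l C" for b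
    proof -
      \<comment> \<open>The connectivity condition at \<open>k = Suc b\<close>; the counter
        \<open>l - 1\<close> stands for \<open>l\<close> factors.\<close>
      have "strongly_connected (with_proj (graph_chain (\<lambda>t. matrix_graph (S t)) (Suc (s + b * l)) (l - 1)))"
        using conn[unfolded repeatedly_jointly_strongly_connected_from_def, rule_format, of "Suc b"]
        by (simp add: add.commute)
      also have "graph_chain (\<lambda>t. matrix_graph (S t)) (Suc (s + b * l)) (l - 1) =
          matrix_graph (matrix_chain (\<lambda>k. S (s + b * l + k)) (Suc (l - 1)))"
        using st by (intro graph_chain_matrix_graph stochastic_nonneg)
      also have "matrix_chain (\<lambda>k. S (s + b * l + k)) (Suc (l - 1)) =
          matrix_chain (restrict (\<lambda>k. S (s + (b * l + k))) {1..l}) l"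
        using l_pos by (simp only: Suc_pred' [symmetric]) (auto intro!: matrix_chain_cong simp: add.assoc)
      finally show ?thesis
        using S unfolding connected_sequences_def by auto
    qed
    have "mixed_norm (chain S (s + q * T)) \<le> rate_power ^ q * 1"
      unfolding chain_add T_def
      by (intro order_trans[OF mixed_norm_mult] mult_mono mixed_norm_chain_le_power blocks
          mixed_norm_chain_le_one st zero_le_power rate_power_nonneg mixed_norm_nonneg)
    moreover have "mixed_norm (chain (\<lambda>k. S (s + q * T + k)) r) \<le> 1"
      by (intro mixed_norm_chain_le_one st) simp
    ultimately have "mixed_norm (chain S t) \<le> 1 * (rate_power ^ q * 1)"
      unfolding t chain_add[of S "s + q * T" r]
      by (intro order_trans[OF mixed_norm_mult] mult_mono mixed_norm_nonneg) auto
    then show ?thesis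
      by (simp add: q_def T_def)
  qed
qed

end

theorem theorem3:
  fixes Pr :: "'m::finite \<Rightarrow> real ^ 'n::finite ^ 'n"
    and P :: "real ^ ('m \<times> 'n) ^ ('m \<times> 'n)"
    and C :: "(real ^ 'm ^ 'm) set"
    and l \<omega> :: nat
    and lam :: real
  assumes "CARD('m) > 1"
    and "\<And>i. orthogonal_projection_matrix (Pr i)"
    and "(\<Inter>i. matrix_image (Pr i)) = {0}"
    and "P = block_diagonal Pr"
    and "l > 0"
    and "l_compact l C"
    and "\<omega> = (CARD('m) - 1)\<^sup>2"
    and "lam = root (\<omega> * l)
           (iterated_sup (connected_sequences l C) \<omega>
             (\<lambda>hs. mixed_norm (projected_chain P (concatenated l hs) (\<omega> * l))))"
  shows "lam < 1 \<and>
    (\<forall>S \<tau>\<^sub>0. (\<forall>t\<ge>1. S t \<in> C) \<longrightarrow> \<tau>\<^sub>0 > 0 \<longrightarrow>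
       repeatedly_jointly_strongly_connected_from \<tau>\<^sub>0 l (\<lambda>t. matrix_graph (S t)) \<longrightarrow>
       (\<forall>t\<ge>1. ereal (mixed_norm (projected_chain P S t))
                \<le> ereal_powi lam (int t - int (l * \<omega>) - max 0 (int \<tau>\<^sub>0 - 2))))"
proof -
  interpret compact_projection_family Pr C l \<omega>
    using assms by unfold_locales auto
  have T_pos: "\<omega> * l > 0"
    using \<omega>_pos l_pos by simp
  have lam: "lam = root (\<omega> * l) rate_power"
    using assms(4,8) by (simp add: rate_power_def)
  have "0 \<le> lam" "lam < 1" and power: "lam ^ (\<omega> * l) = rate_power"
    using T_pos rate_power_nonneg rate_power_less_one
    by (simp_all add: lam real_root_lt_1_iff del: nat_0_less_mult_iff)
  have "ereal (mixed_norm (projected_chain P S t))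
      \<le> ereal_powi lam (int t - int (l * \<omega>) - max 0 (int \<tau>\<^sub>0 - 2))"
    if S: "\<forall>t\<ge>1. S t \<in> C" and "\<tau>\<^sub>0 > 0"
      and conn: "repeatedly_jointly_strongly_connected_from \<tau>\<^sub>0 l (\<lambda>t. matrix_graph (S t))"
    for S \<tau>\<^sub>0 t
  proof -
    obtain s where s: "\<tau>\<^sub>0 = Suc s"
      using \<open>\<tau>\<^sub>0 > 0\<close> gr0_implies_Suc by blast
    define q where "q = (t - s) div (\<omega> * l)"
    have "mixed_norm (projected_chain P S t) \<le> rate_power ^ q"
      using mixed_norm_chain_decay[of S s t] S conn by (simp add: s q_def assms(4))
    also have "\<dots> = lam ^ (\<omega> * l * q)"
      by (simp only: power_mult[of lam "\<omega> * l"] power)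
    finally have "ereal (mixed_norm (projected_chain P S t)) \<le> ereal (lam ^ (\<omega> * l * q))"
      by simp
    also have "\<dots> \<le> ereal_powi lam (int t - int (l * \<omega>) - max 0 (int \<tau>\<^sub>0 - 2))"
    proof (rule power_le_ereal_powi)
      have "t - s = \<omega> * l * q + (t - s) mod (\<omega> * l)"
        by (simp add: q_def)
      moreover have "(t - s) mod (\<omega> * l) < \<omega> * l"
        using T_pos by (rule mod_less_divisor)
      ultimately have "t - s < \<omega> * l * q + l * \<omega>"
        by (simp add: mult.commute)
      \<comment> \<open>The strict inequality leaves one unit to spare, which pays for the first
        unit of delay: for \<open>s > 0\<close> the initial factors lower the exponent only by
        \<open>s - 1\<close>, that is, by \<open>\<tau>\<^sub>0 - 2\<close>.\<close>
      then show "int t - int (l * \<omega>) - max 0 (int \<tau>\<^sub>0 - 2) \<le> int (\<omega> * l * q)"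
        unfolding s by linarith
    qed (use \<open>0 \<le> lam\<close> \<open>lam < 1\<close> in auto)
    finally show ?thesis .
  qed
  with \<open>lam < 1\<close> show ?thesis
    by blast
qed

end
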